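(* If $G$ is a finite simple claw-free graph, then $\chi_{\mathrm{pcf}}(G)=\chi_{\mathrm{o}}(G)\le \frac{3}{2}\Delta(G)+\left\lceil\sqrt{\Delta(G)}\right\rceil$.
   Context: A graph is claw-free if it has no induced subgraph isomorphic to $K_{1,3}$. An odd $k$-coloring of $G$ is a proper $k$-coloring such that every vertex of positive degree has some color appearing an odd number of times on its neighborhood; $\chi_{\mathrm{o}}(G)$ is the minimum such $k$. A proper conflict-free $k$-coloring is a proper $k$-coloring such that every vertex of positive degree has some color appearing exactly once on its neighborhood; $\chi_{\mathrm{pcf}}(G)$ is the minimum such $k$. $\Delta(G)$ is the maximum degree.
   Formalization: The upper bound is stated only for Δ(G) ≥ 1, since it fails for edgeless graphs with at least one vertex (there both chromatic numbers are 1 and the right-hand side is 0); the equality of the two chromatic numbers is stated for every finite simple claw-free graph. *)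

theory Defs
  imports Complex_Main "Graph_Theory.Graph_Theory"
begin

text \<open>
  Finite simple graphs are the models of the locale \<^locale>\<open>graph\<close>: finite, symmetric,
  loop-free digraphs without parallel arcs. An undirected edge is a pair of opposite arcs,
  so the degree of a vertex is its \<^const>\<open>out_degree\<close>, which equals the number of its neighbours.
\<close>

definition claw_free :: "('a, 'b) pre_digraph \<Rightarrow> bool" where
  "claw_free G \<longleftrightarrow> \<not> (\<exists>H. induced_subgraph H G \<and> K\<^bsub>1,3\<^esub> H)"

definition neighbourhood :: "('a, 'b) pre_digraph \<Rightarrow> 'a \<Rightarrow> 'a set" where
  "neighbourhood G v = {u. v \<rightarrow>\<^bsub>G\<^esub> u}"

text \<open>The inserted \<open>0\<close> only matters for the graph without vertices.\<close>

definition max_degree :: "('a, 'b) pre_digraph \<Rightarrow> nat" where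
  "max_degree G = Max (insert 0 (out_degree G ` verts G))"

definition proper_coloring :: "('a, 'b) pre_digraph \<Rightarrow> nat \<Rightarrow> ('a \<Rightarrow> nat) \<Rightarrow> bool" where
  "proper_coloring G k c \<longleftrightarrow>
     c ` verts G \<subseteq> {..<k} \<and> (\<forall>u v. u \<rightarrow>\<^bsub>G\<^esub> v \<longrightarrow> c u \<noteq> c v)"

definition odd_coloring :: "('a, 'b) pre_digraph \<Rightarrow> nat \<Rightarrow> ('a \<Rightarrow> nat) \<Rightarrow> bool" where
  "odd_coloring G k c \<longleftrightarrow> proper_coloring G k c \<and>
     (\<forall>v \<in> verts G. out_degree G v > 0 \<longrightarrow>
        (\<exists>i<k. odd (card {u \<in> neighbourhood G v. c u = i})))"

definition pcf_coloring :: "('a, 'b) pre_digraph \<Rightarrow> nat \<Rightarrow> ('a \<Rightarrow> nat) \<Rightarrow> bool" where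
  "pcf_coloring G k c \<longleftrightarrow> proper_coloring G k c \<and>
     (\<forall>v \<in> verts G. out_degree G v > 0 \<longrightarrow>
        (\<exists>i<k. card {u \<in> neighbourhood G v. c u = i} = 1))"

definition chi_odd :: "('a, 'b) pre_digraph \<Rightarrow> nat" where
  "chi_odd G = (LEAST k. \<exists>c. odd_coloring G k c)"

definition chi_pcf :: "('a, 'b) pre_digraph \<Rightarrow> nat" where
  "chi_pcf G = (LEAST k. \<exists>c. pcf_coloring G k c)"

text \<open>
  Every graph has a proper conflict-free coloring, hence an odd one (color the vertices
  injectively), so both minima above are attained.
\<close>

lemma pcf_coloring_imp_odd_coloring: "pcf_coloring G k c \<Longrightarrow> odd_coloring G k c"
  unfolding pcf_coloring_def odd_coloring_def by (metis odd_one)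

lemma (in graph) ex_pcf_coloring: "\<exists>c. pcf_coloring G (card (verts G)) c"
proof -
  obtain c where c: "bij_betw c (verts G) {0..<card (verts G)}"
    using ex_bij_betw_finite_nat[OF finite_verts] by blast
  have inj: "c x = c y \<longleftrightarrow> x = y" if "x \<in> verts G" "y \<in> verts G" for x y
    using c that by (auto simp: bij_betw_def inj_on_def)
  have lt: "c x < card (verts G)" if "x \<in> verts G" for x
    using c that by (auto simp: bij_betw_def)
  have V: "u \<in> verts G \<and> v \<in> verts G \<and> u \<noteq> v" if "u \<rightarrow> v" for u v
    using that no_loops by (auto simp: arcs_ends_conv)
  have "\<exists>i<card (verts G). card {u \<in> neighbourhood G v. c u = i} = 1"
    if "out_degree G v > 0" for v
  proof -
    from that have "out_arcs G v \<noteq> {}"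
      by (auto simp: out_degree_def)
    then obtain w where w: "v \<rightarrow> w"
      by (auto simp: out_arcs_def arcs_ends_conv)
    then have "{u \<in> neighbourhood G v. c u = c w} = {w}"
      using V inj by (auto simp: neighbourhood_def)
    then show ?thesis
      using V[OF w] lt by (intro exI[of _ "c w"]) auto
  qed
  then have "pcf_coloring G (card (verts G)) c"
    using lt V inj by (auto simp: pcf_coloring_def proper_coloring_def)
  then show ?thesis by blast
qed

end

theory Submission
  imports Defs
begin

text \<open>
  In a claw-free graph no color of a proper coloring occurs three times in a neighbourhood, so an
  odd number of occurrences is a single occurrence, and a vertex \<open>u\<close> is bad if and only if
  every color occurs zero or two times on its neighbourhood.

  A proper coloring with at least \<open>\<lfloor>3\<Delta>/2\<rfloor> + 2\<close> colors and as few bad vertices as possible has none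
  (this many colors are available as soon as \<open>\<Delta> \<ge> 2\<close>, and for \<open>\<Delta> \<le> 1\<close> no vertex is bad).
  Recoloring a neighbour \<open>v\<close> of a bad vertex \<open>u\<close> repairs \<open>u\<close>; the new color must avoid the colors
  on the neighbourhood of \<open>v\<close> and, for each neighbour \<open>w\<close> of \<open>v\<close> (including \<open>u\<close>), the at most one
  color that makes \<open>w\<close> bad. If \<open>w\<close> does forbid a color outside the neighbourhood of \<open>v\<close>, then the
  colors around \<open>w\<close> other than that of \<open>v\<close> are paired up to one exception, so \<open>w\<close> sees only about
  half as many colors as it has neighbours. If such a \<open>w\<close> is adjacent to \<open>u\<close>, recolor \<open>w\<close> instead
  of \<open>v\<close>. Otherwise all such \<open>w \<noteq> u\<close> lie in the set of neighbours of \<open>v\<close> outside the closed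
  neighbourhood of \<open>u\<close>. This set is a clique because there is no claw with leaf \<open>u\<close> at \<open>v\<close>, and since
  the colors of the clique are paired around \<open>w\<close>, it has at most \<open>\<Delta>/2\<close> elements.
\<close>

text \<open>All fibres are pairs apart from one singleton, so one further element over
  \<open>a\<close> would pair \<open>A\<close> up completely.\<close>

lemma card_eq_twice_card_image:
  assumes "finite A" and "\<And>i. i \<in> f ` A \<Longrightarrow> i \<noteq> a \<Longrightarrow> card {x \<in> A. f x = i} = 2"
    and "card {x \<in> A. f x = a} = 1"
  shows "card A + 1 = 2 * card (f ` A)"
proof -
  have fin: "finite (f ` A)" using assms(1) by simp
  have a: "a \<in> f ` A"
  proof -
    have "{x \<in> A. f x = a} \<noteq> {}" using assms(3) by (metis card.empty zero_neq_one)
    then show ?thesis by auto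
  qed
  have "card A = (\<Sum>i\<in>f ` A. card {x \<in> A. f x = i})"
    using sum.image_gen[OF assms(1), of "\<lambda>_. 1 :: nat" f] by simp
  also have "\<dots> = 1 + (\<Sum>i\<in>f ` A - {a}. card {x \<in> A. f x = i})"
    using assms(3) by (simp add: sum.remove[OF fin a])
  also have "(\<Sum>i\<in>f ` A - {a}. card {x \<in> A. f x = i}) = (\<Sum>i\<in>f ` A - {a}. 2)"
    using assms(2) by (intro sum.cong) auto
  also have "\<dots> = 2 * (card (f ` A) - 1)"
    using a fin by simp
  finally show ?thesis
    using a fin by (cases "card (f ` A)") auto
qed

section \<open>Neighbourhoods and greedy proper colorings\<close>

context graph
begin

abbreviation N :: "'a \<Rightarrow> 'a set" where
  "N \<equiv> neighbourhood G"

lemma N_subset_verts: "N v \<subseteq> verts G"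
  by (auto simp: neighbourhood_def adj_in_verts)

lemma finite_N [simp]: "finite (N v)"
  by (rule finite_subset[OF N_subset_verts]) simp

lemma N_sym: "u \<in> N v \<longleftrightarrow> v \<in> N u"
  using arcs_ends_symmetric[OF sym_arcs] by (auto simp: neighbourhood_def)

lemma not_in_N_self [simp]: "v \<notin> N v"
  using adj_not_same by (auto simp: neighbourhood_def)

lemma out_degree_eq_card_N: "out_degree G v = card (N v)"
proof -
  have "N v = head G ` out_arcs G v"
    by (auto simp: neighbourhood_def arcs_ends_conv image_iff)
  moreover have "inj_on (head G) (out_arcs G v)"
    by (rule inj_onI) (auto intro!: no_multi_arcs simp: arc_to_ends_def)
  ultimately show ?thesis
    by (simp add: out_degree_def card_image)
qed

lemma card_N_le_max_degree: "card (N v) \<le> max_degree G"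
proof (cases "v \<in> verts G")
  case True
  then show ?thesis
    unfolding max_degree_def out_degree_eq_card_N[symmetric] by (intro Max_ge) auto
next
  case False
  then have "N v = {}"
    by (auto simp: neighbourhood_def adj_in_verts)
  then show ?thesis by simp
qed

lemma proper_coloring_N_neq: "proper_coloring G k c \<Longrightarrow> u \<in> N v \<Longrightarrow> c u \<noteq> c v"
  unfolding proper_coloring_def neighbourhood_def by (metis mem_Collect_eq)

text \<open>Greedy coloring, vertex by vertex; it supplies a candidate for the later
  minimisation.\<close>

lemma ex_proper_coloring:
  assumes "max_degree G < k"
  shows "\<exists>c. proper_coloring G k c"
proof -
  have "\<exists>c. (\<forall>v\<in>S. c v < k) \<and> (\<forall>u\<in>S. \<forall>v\<in>S \<inter> N u. c u \<noteq> c v)" if "finite S" for S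
    using that
  proof (induction S)
    case empty
    then show ?case by simp
  next
    case (insert x S)
    then obtain c where c: "\<And>v. v \<in> S \<Longrightarrow> c v < k" "\<And>u v. u \<in> S \<Longrightarrow> v \<in> S \<Longrightarrow> v \<in> N u \<Longrightarrow> c u \<noteq> c v"
      by blast
    have "card (c ` N x) < k"
      using card_image_le[of "N x" c] card_N_le_max_degree[of x] assms by simp
    then have "\<not> {..<k} \<subseteq> c ` N x"
      using card_mono[of "c ` N x" "{..<k}"] by auto
    then obtain a where a: "a < k" "a \<notin> c ` N x"
      by auto
    show ?case
      using a c insert.hyps N_sym by (intro exI[of _ "c(x := a)"]) (auto simp: image_iff)
  qed
  from this[OF finite_verts] obtain c where
    "\<forall>v\<in>verts G. c v < k" "\<forall>u\<in>verts G. \<forall>v\<in>verts G \<inter> N u. c u \<noteq> c v"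
    by blast
  then have "proper_coloring G k c"
    using adj_in_verts by (auto simp: proper_coloring_def neighbourhood_def)
  then show ?thesis by blast
qed

section \<open>Bad vertices and the colors a recoloring must avoid\<close>

definition bad :: "('a \<Rightarrow> nat) \<Rightarrow> 'a \<Rightarrow> bool" where
  "bad c v \<longleftrightarrow> N v \<noteq> {} \<and> (\<forall>i. card {u \<in> N v. c u = i} \<noteq> 1)"

lemma pcf_coloring_iff_no_bad:
  "pcf_coloring G k c \<longleftrightarrow> proper_coloring G k c \<and> (\<forall>v\<in>verts G. \<not> bad c v)"
proof -
  have "i < k" if "proper_coloring G k c" "card {u \<in> N v. c u = i} = 1" for v i
  proof -
    have "{u \<in> N v. c u = i} \<noteq> {}"
      using that(2) by (metis card.empty zero_neq_one)
    then show ?thesis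
      using that(1) N_subset_verts by (fastforce simp: proper_coloring_def)
  qed
  then have "(\<exists>i<k. card {u \<in> N v. c u = i} = 1) \<longleftrightarrow> (\<exists>i. card {u \<in> N v. c u = i} = 1)"
    if "proper_coloring G k c" for v
    using that by blast
  then show ?thesis
    unfolding pcf_coloring_def bad_def out_degree_eq_card_N by (auto simp: card_gt_0_iff)
qed

text \<open>For a neighbour \<open>v\<close> of \<open>w\<close>: giving \<open>v\<close> the color
  \<open>a\<close> makes \<open>w\<close> bad. Deleting \<open>v\<close> makes this independent of
  the present color of \<open>v\<close>.\<close>

definition spoils :: "('a \<Rightarrow> nat) \<Rightarrow> 'a \<Rightarrow> 'a \<Rightarrow> nat \<Rightarrow> bool" where
  "spoils c v w a \<longleftrightarrow> card {x \<in> N w - {v}. c x = a} = 1 \<and>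
     (\<forall>i. i \<noteq> a \<longrightarrow> card {x \<in> N w - {v}. c x = i} \<noteq> 1)"

lemma spoils_unique: "spoils c v w a \<Longrightarrow> spoils c v w b \<Longrightarrow> a = b"
  unfolding spoils_def by metis

definition spoilers :: "('a \<Rightarrow> nat) \<Rightarrow> 'a \<Rightarrow> 'a set" where
  "spoilers c v = {w \<in> N v. \<exists>a. a \<notin> c ` N v \<and> spoils c v w a}"

definition forbidden :: "('a \<Rightarrow> nat) \<Rightarrow> 'a \<Rightarrow> nat set" where
  "forbidden c v = c ` N v \<union> {a. \<exists>w\<in>N v. spoils c v w a}"

lemma spoilers_subset: "spoilers c v \<subseteq> N v"
  by (auto simp: spoilers_def)

lemma finite_spoilers [simp]: "finite (spoilers c v)"
  by (rule finite_subset[OF spoilers_subset]) simp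

text \<open>By \<open>spoils_unique\<close> each spoiler adds at most one color to those on
  \<open>N v\<close>, and \<open>THE\<close> picks it out.\<close>

lemma forbidden_subset:
  "forbidden c v \<subseteq> c ` N v \<union> (\<lambda>w. THE a. spoils c v w a) ` spoilers c v"
proof
  fix a assume a: "a \<in> forbidden c v"
  show "a \<in> c ` N v \<union> (\<lambda>w. THE a. spoils c v w a) ` spoilers c v"
  proof (cases "a \<in> c ` N v")
    case False
    with a obtain w where w: "w \<in> N v" "spoils c v w a"
      by (auto simp: forbidden_def)
    then have "(THE a. spoils c v w a) = a"
      using spoils_unique by blast
    with w False show ?thesis
      unfolding spoilers_def by (intro UnI2 rev_image_eqI[of w]) auto
  qed simp
qed

lemma finite_forbidden [simp]: "finite (forbidden c v)"
  by (rule finite_subset[OF forbidden_subset]) simp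

lemma card_forbidden_le: "card (forbidden c v) \<le> card (c ` N v) + card (spoilers c v)"
proof -
  have "card (forbidden c v)
      \<le> card (c ` N v \<union> (\<lambda>w. THE a. spoils c v w a) ` spoilers c v)"
    by (rule card_mono[OF _ forbidden_subset]) simp
  also have "\<dots> \<le> card (c ` N v) + card ((\<lambda>w. THE a. spoils c v w a) ` spoilers c v)"
    by (rule card_Un_le)
  also have "\<dots> \<le> card (c ` N v) + card (spoilers c v)"
    by (simp add: card_image_le)
  finally show ?thesis .
qed

end

section \<open>Color classes in neighbourhoods of a claw-free graph\<close>

locale claw_free_graph = graph +
  assumes claw_free: "claw_free G"
begin

lemma adjacent_in_N:
  assumes "x \<in> N v" "y \<in> N v" "z \<in> N v" "x \<noteq> y" "x \<noteq> z" "y \<noteq> z"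
  shows "y \<in> N x \<or> z \<in> N x \<or> z \<in> N y"
proof (rule ccontr)
  assume na: "\<not> ?thesis"
  define W where "W = {v, x, y, z}"
  define H where "H = G \<restriction> W"
  have W: "W \<subseteq> verts G"
    using assms N_subset_verts N_sym[of x v] unfolding W_def by blast
  have ind: "induced_subgraph H G"
    unfolding H_def using W by (rule induced_induce)
  have v: "v \<noteq> x" "v \<noteq> y" "v \<noteq> z"
    using assms by auto
  have ends: "arcs_ends H = {(a, b). a \<in> W \<and> b \<in> W \<and> b \<in> N a}"
    unfolding H_def by (auto simp: arcs_ends_conv neighbourhood_def image_iff)
  have "arcs_ends H = {v} \<times> {x, y, z} \<union> {x, y, z} \<times> {v}"
  proof (intro set_eqI iffI)
    fix p assume "p \<in> arcs_ends H"
    then show "p \<in> {v} \<times> {x, y, z} \<union> {x, y, z} \<times> {v}"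
      unfolding ends W_def using na N_sym by auto
  next
    fix p assume "p \<in> {v} \<times> {x, y, z} \<union> {x, y, z} \<times> {v}"
    then show "p \<in> arcs_ends H"
      unfolding ends W_def using assms N_sym by auto
  qed
  moreover have "verts H = {v} \<union> {x, y, z}" "{v} \<inter> {x, y, z} = {}"
    using v by (auto simp: H_def W_def)
  moreover have "card {v} = 1" "card {x, y, z} = 3"
    using assms by auto
  moreover have "graph H"
  proof -
    interpret H: wf_digraph H
      unfolding H_def using W by (intro wellformed_induce_subgraph)
    show ?thesis
    proof unfold_locales
      show "finite (verts H)" "finite (arcs H)"
        by (simp_all add: H_def W_def)
      show "tail H e \<noteq> head H e" if "e \<in> arcs H" for e
        using that no_loops by (auto simp: H_def)
      show "e = f" if "e \<in> arcs H" "f \<in> arcs H" "arc_to_ends H e = arc_to_ends H f" for e f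
        using that no_multi_arcs by (auto simp: H_def arc_to_ends_def)
      show "symmetric H"
        using N_sym by (auto simp: symmetric_def sym_def ends)
    qed
  qed
  ultimately have "K\<^bsub>1,3\<^esub> H"
    unfolding complete_bipartite_digraph_def by blast
  with ind claw_free show False
    unfolding claw_free_def by blast
qed

text \<open>Vertices of equal color are nonadjacent, so three of them around \<open>v\<close> would
  be the leaves of a claw.\<close>

lemma card_color_class_le_2:
  assumes "proper_coloring G k c"
  shows "card {u \<in> N v. c u = i} \<le> 2"
proof (rule ccontr)
  assume "\<not> ?thesis"
  then obtain T where T: "T \<subseteq> {u \<in> N v. c u = i}" "card T = 3"
    using obtain_subset_with_card_n[of 3 "{u \<in> N v. c u = i}"] by auto
  then obtain x y z where xyz: "T = {x, y, z}" "x \<noteq> y" "x \<noteq> z" "y \<noteq> z"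
    by (auto simp: card_3_iff)
  with T(1) have "x \<in> N v" "y \<in> N v" "z \<in> N v" "c x = i" "c y = i" "c z = i"
    by auto
  with xyz show False
    using adjacent_in_N[of x v y z] proper_coloring_N_neq[OF assms] by metis
qed

lemma odd_coloring_iff_pcf_coloring: "odd_coloring G k c \<longleftrightarrow> pcf_coloring G k c"
proof (cases "proper_coloring G k c")
  case True
  have "odd n \<longleftrightarrow> n = 1" if "n \<le> 2" for n :: nat
    using that by presburger
  then have "odd (card {u \<in> N v. c u = i}) \<longleftrightarrow> card {u \<in> N v. c u = i} = 1" for v i
    using card_color_class_le_2[OF True] by blast
  then show ?thesis
    by (simp only: odd_coloring_def pcf_coloring_def)
qed (simp add: odd_coloring_def pcf_coloring_def)

lemma card_color_class_eq_2:
  assumes "proper_coloring G k c" "A \<subseteq> N v" "i \<in> c ` A" "card {x \<in> A. c x = i} \<noteq> 1"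
  shows "card {x \<in> A. c x = i} = 2"
proof -
  have "finite A"
    using assms(2) by (rule finite_subset) simp
  then have "card {x \<in> A. c x = i} \<le> card {x \<in> N v. c x = i}" "card {x \<in> A. c x = i} \<noteq> 0"
    using assms(2,3) by (auto intro!: card_mono)
  then show ?thesis
    using card_color_class_le_2[OF assms(1), of v i] assms(4) by linarith
qed

text \<open>Around \<open>w\<close> without \<open>v\<close>, color \<open>a\<close> occurs once and
  every other occurring color twice; \<open>v\<close> itself restores the missing element.\<close>

lemma card_N_of_spoils:
  assumes "proper_coloring G k c" "v \<in> N w" "spoils c v w a"
  shows "card (N w) = 2 * card (c ` (N w - {v}))"
proof -
  have "card (N w - {v}) + 1 = 2 * card (c ` (N w - {v}))"
  proof (rule card_eq_twice_card_image)
    show "card {x \<in> N w - {v}. c x = i} = 2" if "i \<in> c ` (N w - {v})" "i \<noteq> a" for i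
      using that assms(3)
      by (intro card_color_class_eq_2[OF assms(1), of _ w]) (auto simp: spoils_def)
    show "card {x \<in> N w - {v}. c x = a} = 1"
      using assms(3) by (simp add: spoils_def)
  qed simp
  then show ?thesis
    using assms(2) card_Suc_Diff1[of "N w" v] by simp
qed

text \<open>Each color occurring around a bad \<open>u\<close> occurs exactly twice, so deleting
  \<open>v\<close> breaks only the pair of color \<open>c v\<close>.\<close>

lemma bad_imp_spoils:
  assumes "proper_coloring G k c" "bad c u" "v \<in> N u"
  shows "spoils c v u (c v)"
  unfolding spoils_def
proof (intro conjI allI impI)
  have "card {x \<in> N u. c x = c v} = 2"
    using assms by (intro card_color_class_eq_2[OF assms(1), of _ u]) (auto simp: bad_def)
  moreover have "{x \<in> N u - {v}. c x = c v} = {x \<in> N u. c x = c v} - {v}"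
    by auto
  ultimately show "card {x \<in> N u - {v}. c x = c v} = 1"
    using assms(3) by (simp add: card_Diff_singleton)
next
  fix i assume "i \<noteq> c v"
  then have "{x \<in> N u - {v}. c x = i} = {x \<in> N u. c x = i}"
    by auto
  then show "card {x \<in> N u - {v}. c x = i} \<noteq> 1"
    using assms(2) by (simp add: bad_def)
qed

section \<open>Recoloring a neighbour of a bad vertex\<close>

lemma bad_recolor_imp_spoils:
  assumes "proper_coloring G k (c(v := a))" "v \<in> N w" "bad (c(v := a)) w"
  shows "spoils c v w a"
proof -
  \<comment> \<open>\<open>spoils\<close> ignores the color of \<open>v\<close>, so it holds for
    \<open>c\<close> once it holds for the new coloring.\<close>
  have "{x \<in> N w - {v}. (c(v := a)) x = i} = {x \<in> N w - {v}. c x = i}" for i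
    by auto
  then show ?thesis
    using bad_imp_spoils[OF assms(1,3,2)] by (simp add: spoils_def)
qed

text \<open>Only neighbours of \<open>v\<close> see its new color, and an allowed color leaves all
  of them good, among them \<open>u\<close>.\<close>

lemma recolor_decreases_bad:
  assumes "proper_coloring G k c" "bad c u" "v \<in> N u" "a < k" "a \<notin> forbidden c v"
  shows "proper_coloring G k (c(v := a))"
    and "{w \<in> verts G. bad (c(v := a)) w} \<subset> {w \<in> verts G. bad c w}"
proof -
  show proper: "proper_coloring G k (c(v := a))"
    using assms(1,4,5) N_sym
    by (auto simp: proper_coloring_def forbidden_def neighbourhood_def image_iff)
  have good: "\<not> bad (c(v := a)) w" if "w \<in> N v" for w
    using that assms(5) N_sym bad_recolor_imp_spoils[OF proper, of w]
    by (auto simp: forbidden_def)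
  have "bad c w" if "bad (c(v := a)) w" for w
  proof -
    have "v \<notin> N w"
      using that good N_sym by blast
    then have "{x \<in> N w. (c(v := a)) x = i} = {x \<in> N w. c x = i}" for i
      by auto
    with that show ?thesis
      by (simp add: bad_def)
  qed
  moreover have "u \<in> verts G" "\<not> bad (c(v := a)) u"
    using assms(3) N_sym N_subset_verts good by blast+
  ultimately show "{w \<in> verts G. bad (c(v := a)) w} \<subset> {w \<in> verts G. bad c w}"
    using assms(2) by blast
qed

lemma ex_neighbour_few_forbidden:
  assumes "proper_coloring G k c" "bad c u"
  shows "\<exists>v\<in>N u. 2 * card (forbidden c v) \<le> 3 * max_degree G + 2"
proof -
  obtain v where v: "v \<in> N u"
    using assms(2) by (auto simp: bad_def)
  show ?thesis
  proof (cases "spoilers c v \<inter> N u = {}")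
    case False
    then obtain w a where w: "w \<in> N u" "w \<in> N v" "spoils c v w a"
      by (auto simp: spoilers_def)
    have vw: "v \<in> N w"
      using w N_sym by blast
    \<comment> \<open>With n = \<open>card (N w)\<close>, at most n/2 + 1 colors occur on
      \<open>N w\<close> and there are at most n spoilers, so recoloring \<open>w\<close> avoids at
      most 3n/2 + 1 colors.\<close>
    have "c ` N w \<subseteq> insert (c v) (c ` (N w - {v}))"
      by auto
    then have "card (c ` N w) \<le> card (insert (c v) (c ` (N w - {v})))"
      by (intro card_mono) auto
    also have "\<dots> \<le> card (c ` (N w - {v})) + 1"
      by (simp add: card_insert_if)
    finally have "card (c ` N w) \<le> card (c ` (N w - {v})) + 1" .
    moreover have "card (spoilers c w) \<le> card (N w)"
      by (intro card_mono spoilers_subset) simp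
    ultimately have "2 * card (forbidden c w) \<le> 3 * max_degree G + 2"
      using card_forbidden_le[of c w] card_N_of_spoils[OF assms(1) vw w(3)]
        card_N_le_max_degree[of w] by linarith
    with w(1) show ?thesis ..
  next
    case True
    define Q where "Q = N v - N u - {u}"
    have finQ: "finite Q"
      by (simp add: Q_def)
    have uv: "u \<in> N v"
      using v N_sym by blast
    \<comment> \<open>\<open>u\<close> has no neighbour in \<open>Q\<close>, so two nonadjacent
      vertices of \<open>Q\<close> would form a claw at \<open>v\<close> together with
      \<open>u\<close>.\<close>
    have clique: "q \<in> N w" if "q \<in> Q" "w \<in> Q" "q \<noteq> w" for q w
      using that uv adjacent_in_N[of u v q w] N_sym by (auto simp: Q_def)
    have sub: "spoilers c v \<subseteq> insert u (spoilers c v \<inter> Q)"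
      using True spoilers_subset by (auto simp: Q_def)
    have half: "2 * card (spoilers c v \<inter> Q) \<le> max_degree G"
    proof (cases "spoilers c v \<inter> Q = {}")
      case False
      then obtain w a where w: "w \<in> Q" "w \<in> N v" "a \<notin> c ` N v" "spoils c v w a"
        by (auto simp: spoilers_def)
      have vw: "v \<in> N w"
        using w N_sym by blast
      \<comment> \<open>\<open>Q - {w}\<close> shows \<open>card Q - 1\<close> distinct colors
        around \<open>w\<close>, and \<open>a\<close>, absent from \<open>N v\<close>, is one more.
        Hence \<open>card Q\<close> is at most half of \<open>card (N w)\<close>.\<close>
      have "{x \<in> N w - {v}. c x = a} \<noteq> {}"
        using w(4) unfolding spoils_def by (metis card.empty zero_neq_one)
      then have "a \<in> c ` (N w - {v})"
        by blast
      moreover have "v \<notin> Q"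
        by (simp add: Q_def)
      then have "Q - {w} \<subseteq> N w - {v}"
        using clique w(1) by blast
      ultimately have "insert a (c ` (Q - {w})) \<subseteq> c ` (N w - {v})"
        by (simp add: image_mono)
      then have "card (insert a (c ` (Q - {w}))) \<le> card (c ` (N w - {v}))"
        by (intro card_mono) auto
      moreover have "a \<notin> c ` (Q - {w})"
        using w(3) by (auto simp: Q_def)
      moreover have "inj_on c Q"
        using clique proper_coloring_N_neq[OF assms(1)] by (meson inj_onI)
      then have "card (c ` (Q - {w})) = card Q - 1"
        using w(1) finQ by (simp add: card_image inj_on_diff card_Diff_singleton)
      ultimately have "card Q \<le> card (c ` (N w - {v}))"
        using finQ by simp
      moreover have "card (spoilers c v \<inter> Q) \<le> card Q"
        using finQ by (intro card_mono) auto
      ultimately show ?thesis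
        using card_N_of_spoils[OF assms(1) vw w(4)] card_N_le_max_degree[of w] by linarith
    qed simp
    \<comment> \<open>The only possible spoiler outside \<open>Q\<close> is \<open>u\<close>, which
      accounts for the added 1.\<close>
    have "card (spoilers c v) \<le> card (insert u (spoilers c v \<inter> Q))"
      using sub by (intro card_mono) auto
    also have "\<dots> \<le> card (spoilers c v \<inter> Q) + 1"
      by (simp add: card_insert_if)
    finally have "2 * card (forbidden c v) \<le> 3 * max_degree G + 2"
      using half card_forbidden_le[of c v] card_image_le[of "N v" c]
        card_N_le_max_degree[of v] by simp
    with v show ?thesis ..
  qed
qed

lemma bad_imp_max_degree_ge_2:
  assumes "proper_coloring G k c" "bad c u"
  shows "max_degree G \<ge> 2"
proof -
  obtain v where v: "v \<in> N u"
    using assms(2) by (auto simp: bad_def)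
  then have "card {x \<in> N u. c x = c v} = 2"
    using assms by (intro card_color_class_eq_2[OF assms(1), of _ u]) (auto simp: bad_def)
  moreover have "card {x \<in> N u. c x = c v} \<le> card (N u)"
    by (intro card_mono) auto
  ultimately show ?thesis
    using card_N_le_max_degree[of u] by linarith
qed

text \<open>A proper coloring with fewest bad vertices has none, as recoloring would reduce their
  number. The second bound is conditional so that two colors are allowed at maximum degree
  1.\<close>

lemma ex_pcf_coloring_of_many_colors:
  assumes "max_degree G < k" "max_degree G \<ge> 2 \<Longrightarrow> 3 * max_degree G + 2 < 2 * k"
  shows "\<exists>c. pcf_coloring G k c"
proof -
  define B where "B c = {w \<in> verts G. bad c w}" for c
  have finB: "finite (B c)" for c
    by (simp add: B_def)
  obtain c where c: "proper_coloring G k c"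
    and min: "\<And>c'. proper_coloring G k c' \<Longrightarrow> card (B c) \<le> card (B c')"
    using ex_proper_coloring[OF assms(1)]
      ex_has_least_nat[of "proper_coloring G k" _ "\<lambda>c. card (B c)"] by metis
  have "\<not> bad c u" for u
  proof
    assume u: "bad c u"
    obtain v where v: "v \<in> N u" "2 * card (forbidden c v) \<le> 3 * max_degree G + 2"
      using ex_neighbour_few_forbidden[OF c u] by blast
    then have "card (forbidden c v) < k"
      using assms(2) bad_imp_max_degree_ge_2[OF c u] by linarith
    then have "\<not> {..<k} \<subseteq> forbidden c v"
      using card_mono[of "forbidden c v" "{..<k}"] by auto
    then obtain a where a: "a < k" "a \<notin> forbidden c v"
      by auto
    have "card (B (c(v := a))) < card (B c)"
      using recolor_decreases_bad(2)[OF c u v(1) a] finB by (simp add: B_def psubset_card_mono)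
    with min[OF recolor_decreases_bad(1)[OF c u v(1) a]] show False
      by linarith
  qed
  with c show ?thesis
    using pcf_coloring_iff_no_bad by blast
qed

end

theorem theorem1p9:
  fixes G :: "('a, 'b) pre_digraph"
  assumes "graph G" and "claw_free G"
  shows "chi_pcf G = chi_odd G \<and>
    (max_degree G \<ge> 1 \<longrightarrow>
      real (chi_odd G) \<le> 3 / 2 * real (max_degree G) + real_of_int \<lceil>sqrt (real (max_degree G))\<rceil>)"
proof (intro conjI impI)
  interpret claw_free_graph G
    using assms by (simp add: claw_free_graph_def claw_free_graph_axioms_def)
  show eq: "chi_pcf G = chi_odd G"
    by (simp add: chi_pcf_def chi_odd_def odd_coloring_iff_pcf_coloring)
  define d where "d = max_degree G"
  assume "max_degree G \<ge> 1"
  then have d: "d \<ge> 1"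
    by (simp add: d_def)
  show "real (chi_odd G)
    \<le> 3 / 2 * real (max_degree G) + real_of_int \<lceil>sqrt (real (max_degree G))\<rceil>"
  \<comment> \<open>For \<open>d = 1\<close> the general \<open>k\<close> would be 3, above the
    bound 5/2, so two colors are used.\<close>
  proof (cases "d = 1")
    case True
    then obtain c where "pcf_coloring G 2 c"
      using ex_pcf_coloring_of_many_colors[of 2] by (auto simp: d_def)
    then have "chi_odd G \<le> 2"
      unfolding eq[symmetric] chi_pcf_def by (intro Least_le) blast
    with True show ?thesis
      by (simp add: d_def)
  next
    case False
    \<comment> \<open>This is the least \<open>k\<close> with
      \<open>3 * d + 2 < 2 * k\<close>.\<close>
    define k where "k = 3 * d div 2 + 2"
    have "d < k" "3 * d + 2 < 2 * k"
      unfolding k_def by presburger+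
    then obtain c where "pcf_coloring G k c"
      using ex_pcf_coloring_of_many_colors[of k] by (auto simp: d_def)
    then have "chi_odd G \<le> k"
      unfolding eq[symmetric] chi_pcf_def by (intro Least_le) blast
    moreover have "2 * k \<le> 3 * d + 4"
      unfolding k_def by presburger
    ultimately have "real (chi_odd G) \<le> 3 / 2 * real d + 2"
      by linarith
    \<comment> \<open>From \<open>d \<ge> 2\<close> on the root exceeds 1, so its ceiling absorbs
      the constant 2.\<close>
    moreover have "\<lceil>sqrt (real d)\<rceil> \<ge> 2"
      using d False by (simp add: le_ceiling_iff)
    then have "real_of_int \<lceil>sqrt (real d)\<rceil> \<ge> 2"
      by linarith
    ultimately show ?thesis
      unfolding d_def by linarith
  qed
qed

end
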